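(* Let $p>3$ be a prime, let $q$ be a power of $p$, and set $\varepsilon=\left(\frac{q}{3}\right)$, so that $\varepsilon=\pm1$ according to whether $q\equiv\pm1\pmod 3$. Let $s$ be an indeterminate and set $x=4s^2/\bigl(27(s^2-1)\bigr)$. Then the following congruences of polynomials in $s$ hold: $$2(1-s^2)^{(2q-3+\varepsilon)/6}\sum_{0\le k<q/3}\binom{3k}{k}x^k\equiv(1+s)^{(2q+\varepsilon)/3}+(1-s)^{(2q+\varepsilon)/3}\pmod{p},$$ and $$2(1-s^2)^{(4q-3-\varepsilon)/6}\sum_{0\le k<2q/3}\binom{3k}{k}x^k\equiv(1+s)^{(q-\varepsilon)/3}\left(1-\frac{s^q}{3}\right)+(1-s)^{(q-\varepsilon)/3}\left(1+\frac{s^q}{3}\right)\pmod{p}.$$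
   Context: Here $q=p^f$ with $f\ge 1$, $\left(\frac{q}{3}\right)$ is the Legendre symbol, and the sums are over integers $k$ in the indicated ranges. All exponents appearing are nonnegative integers; $(2q-3+\varepsilon)/6$ is the largest integer less than $q/3$ and $(4q-3-\varepsilon)/6$ is the largest integer less than $2q/3$, so that multiplying the sums by the indicated powers of $1-s^2$ clears the powers of $s^2-1$ in the denominators. Both sides are then polynomials in $s$ with coefficients in the ring $\mathbb{Z}_{(p)}$ of rationals with denominator prime to $p$ (since $p>3$), and a congruence modulo $p$ means that the difference of the two sides lies in $p\,\mathbb{Z}_{(p)}[s]$. *)

theory Defs
  imports "HOL-Number_Theory.Number_Theory" "HOL-Computational_Algebra.Computational_Algebra"
begin

definition int_localization :: "nat \<Rightarrow> rat set" where
  "int_localization p = {of_int a / of_int b | a b. \<not> int p dvd b}"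

text \<open>
  Since \<open>x = 4s\<^sup>2/(27(s\<^sup>2 - 1))\<close> is not a polynomial, both sides of the congruences live in the
  field \<open>rat poly fract\<close> of rational functions. Congruence modulo \<open>p\<close> means that the difference
  is (the image of) a polynomial in \<open>p \<int>\<^sub>(\<^sub>p\<^sub>)[s]\<close>; if one side is in \<open>\<int>\<^sub>(\<^sub>p\<^sub>)[s]\<close>, then so is
  the other.

  The exponents of the congruences are written with \<open>div\<close> and \<open>nat\<close> on integers. For
  \<open>q\<close> prime to 6 and \<open>\<epsilon> = Legendre q 3 = \<plusminus>1 \<equiv> q (mod 3)\<close> these divisions are exact and the
  quotients nonnegative, so nothing is truncated.
\<close>

definition rfun_cong :: "nat \<Rightarrow> rat poly fract \<Rightarrow> rat poly fract \<Rightarrow> bool" where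
  "rfun_cong p F G \<longleftrightarrow>
     (\<exists>r :: rat poly. (\<forall>i. coeff r i \<in> int_localization p) \<and>
        F - G = to_fract (smult (of_nat p) r))"

end

theory Submission
  imports Defs
begin

text \<open>
  Write \<open>N\<close> for the largest index of either sum and \<open>(b)\<^sub>k\<close> for the rising factorial. Since
  \<open>binomial(3k, k) (4/27)^k = (1/3)\<^sub>k (2/3)\<^sub>k / ((1/2)\<^sub>k k!)\<close>, the coefficient of \<open>s^(2m)\<close> in
  \<open>(1 - s^2)^N \<Sum> binomial(3k, k) x^k\<close> is up to signs a sum of products of the numbers \<open>binomial(3k, k) (4/27)^k\<close>
  and \<open>binomial(N - k, m - k)\<close>. The number \<open>N\<close> is congruent to \<open>-\<beta>\<close> modulo \<open>q\<close> for some
  \<open>\<beta> \<in> {1/3, 2/3}\<close>, and modulo \<open>p\<close> a binomial coefficient with lower index below \<open>q\<close> only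
  depends on the upper index modulo \<open>q\<close>. So \<open>N\<close> may be replaced by \<open>-\<beta>\<close>; then one of the factors
  \<open>(1/3)\<^sub>k\<close>, \<open>(2/3)\<^sub>k\<close> cancels, and Vandermonde's identity evaluates the sum to
  \<open>binomial(1 - 2\<beta>, 2m)\<close>. Finally \<open>1 - 2\<beta>\<close> differs from the exponents on the right by a multiple
  of \<open>q\<close>; in the second congruence \<open>2m\<close> may exceed \<open>q\<close>, and the reduction
  \<open>(1 + s)^(c + q d) \<equiv> (1 + s)^c (1 + d s^q)\<close> modulo \<open>s^(2q)\<close> produces the terms \<open>s^q / 3\<close>.
\<close>

section \<open>Exact binomial identities\<close>

text \<open>Each term is the product of \<open>(-\<gamma>) gchoose k\<close> and
  \<open>(\<delta> + of_nat m - 1) gchoose (m - k)\<close>, so the Chu-Vandermonde convolution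
  applies.\<close>

lemma sum_pochhammer_Vandermonde:
  fixes \<gamma> \<delta> :: "'a :: field_char_0"
  shows "(\<Sum>k\<le>m. (-1) ^ k * pochhammer \<gamma> k * pochhammer (\<delta> + of_nat k) (m - k) / (fact k * fact (m - k)))
       = pochhammer (\<delta> - \<gamma>) m / fact m"
proof -
  have "(\<Sum>k\<le>m. (-1) ^ k * pochhammer \<gamma> k * pochhammer (\<delta> + of_nat k) (m - k) / (fact k * fact (m - k)))
      = (\<Sum>k=0..m. ((-\<gamma>) gchoose k) * ((\<delta> + of_nat m - 1) gchoose (m - k)))"
  proof (rule sum.cong)
    fix k assume "k \<in> {0..m}"
    then show "(-1) ^ k * pochhammer \<gamma> k * pochhammer (\<delta> + of_nat k) (m - k) / (fact k * fact (m - k))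
      = ((-\<gamma>) gchoose k) * ((\<delta> + of_nat m - 1) gchoose (m - k))"
      by (simp add: gbinomial_pochhammer[of "-\<gamma>"] gbinomial_pochhammer'[of "\<delta> + _ - 1"] of_nat_diff)
  qed auto
  also have "\<dots> = (\<delta> + of_nat m - 1 - \<gamma>) gchoose m"
    by (simp add: gbinomial_Vandermonde algebra_simps)
  also have "\<dots> = pochhammer (\<delta> - \<gamma>) m / fact m"
    by (simp add: gbinomial_pochhammer' algebra_simps)
  finally show ?thesis .
qed

text \<open>With the binomial written in factorials and \<open>fact (2 * k)\<close> moved to the
  right, both sides are multiplied by the same factor when \<open>k\<close> grows by one: the
  constant 4/27 balances the factors 3^3 and 2^2 taken out of (3k+1)(3k+2)(3k+3) and
  (2k+1)(2k+2).\<close>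

lemma binomial_3k_k_pochhammer:
  "of_nat ((3 * k) choose k) * (4 / 27) ^ k * pochhammer (1 / 2) k * fact k
     = (pochhammer (1 / 3) k * pochhammer (2 / 3) k :: 'a :: field_char_0)"
proof -
  have *: "(of_nat ((3 * k) choose k) :: 'a) = fact (3 * k) / (fact k * fact (2 * k))" for k
    by (simp add: binomial_fact)
  have "fact (3 * k) * (4 / 27) ^ k * pochhammer (1 / 2) k
        = (pochhammer (1 / 3) k * pochhammer (2 / 3) k * fact (2 * k) :: 'a)"
  proof (induction k)
    case (Suc k)
    define K where "K = (of_nat k :: 'a)"
    have f3: "fact (3 * Suc k) = (3 * K + 3) * (3 * K + 2) * (3 * K + 1) * (fact (3 * k) :: 'a)"
      by (simp add: numeral_eq_Suc K_def algebra_simps)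
    have f2: "fact (2 * Suc k) = (2 * K + 2) * (2 * K + 1) * (fact (2 * k) :: 'a)"
      by (simp add: numeral_eq_Suc K_def algebra_simps)
    have "fact (3 * Suc k) * (4 / 27) ^ Suc k * pochhammer (1 / 2) (Suc k)
      = (fact (3 * k) * (4 / 27) ^ k * pochhammer (1 / 2) k) *
        ((3 * K + 3) * (3 * K + 2) * (3 * K + 1) * (4 / 27) * (1 / 2 + K))"
      unfolding f3 pochhammer_Suc K_def by (simp only: power_Suc mult_ac)
    also have "(3 * K + 3) * (3 * K + 2) * (3 * K + 1) * (4 / 27) * (1 / 2 + K)
        = (1 / 3 + K) * (2 / 3 + K) * ((2 * K + 2) * (2 * K + 1))"
      by (simp add: field_simps)
    also have "(fact (3 * k) * (4 / 27) ^ k * pochhammer (1 / 2) k) * \<dots> =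
       pochhammer (1 / 3) (Suc k) * pochhammer (2 / 3) (Suc k) * fact (2 * Suc k)"
      unfolding Suc.IH f2 pochhammer_Suc K_def by (simp only: mult_ac)
    finally show ?case .
  qed simp
  then show ?thesis unfolding * by (simp add: field_simps)
qed

text \<open>The numbers \<open>\<beta>\<close> and \<open>1 - \<beta>\<close> are 1/3 and 2/3 in
  some order. Hence one of the two rising factorials in the numerator completes the generalized
  binomial to \<open>pochhammer \<beta> m\<close>, which leaves the sum, and the other one remains
  for Vandermonde.\<close>

lemma sum_binomial_gbinomial:
  fixes \<beta> :: "'a :: field_char_0"
  assumes "\<beta> = 1 / 3 \<or> \<beta> = 2 / 3"
  shows "(\<Sum>k\<le>m. of_nat ((3 * k) choose k) * (- 4 / 27) ^ k * (-1) ^ (m - k) * ((- \<beta> - of_nat k) gchoose (m - k)))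
       = (1 - 2 * \<beta>) gchoose (2 * m)"
proof -
  \<comment> \<open>A zero factor would make the odd number \<open>2 * j + 1\<close> vanish in
    characteristic 0.\<close>
  have half: "pochhammer (1 / 2 :: 'a) k \<noteq> 0" for k
  proof
    assume "pochhammer (1 / 2 :: 'a) k = 0"
    then obtain j where j: "(1 / 2 :: 'a) = - of_nat j" by (auto simp: pochhammer_eq_0_iff)
    have "of_nat (2 * j + 1) = 2 * ((1 / 2 :: 'a) + of_nat j)" by (simp add: field_simps)
    also have "\<dots> = 0" by (simp only: j) simp
    finally have "of_nat (2 * j + 1) = (0 :: 'a)" .
    then show False by (simp only: of_nat_eq_0_iff)
  qed
  \<comment> \<open>The splitting of \<open>pochhammer \<beta> m\<close> and
    \<open>pochhammer (1 / 2) m\<close> at \<open>k\<close> turns everything outside the Vandermonde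
    summand (with \<gamma> = 1 - \<beta> and \<delta> = 1/2) into a factor free of
    \<open>k\<close>.\<close>
  have 1: "of_nat ((3 * k) choose k) * (- 4 / 27) ^ k * (-1) ^ (m - k) * ((- \<beta> - of_nat k) gchoose (m - k))
      = pochhammer \<beta> m / pochhammer (1 / 2) m *
        ((-1) ^ k * pochhammer (1 - \<beta>) k * pochhammer (1 / 2 + of_nat k) (m - k) / (fact k * fact (m - k)))"
    if "k \<le> m" for k
  proof -
    have "pochhammer \<beta> k * pochhammer (1 - \<beta>) k = pochhammer (1 / 3) k * pochhammer (2 / 3) k"
      using assms by (elim disjE; hypsubst) (simp_all add: mult.commute)
    then have c: "of_nat ((3 * k) choose k) * (4 / 27) ^ k = pochhammer \<beta> k * pochhammer (1 - \<beta>) k / (pochhammer (1 / 2) k * fact k)"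
      using binomial_3k_k_pochhammer[of k, where 'a='a] half[of k] by (simp add: eq_divide_eq mult.assoc)
    have e1: "(- 4 / 27 :: 'a) ^ k = (-1) ^ k * (4 / 27) ^ k"
      by (simp flip: power_mult_distrib)
    have e2: "(-1) ^ (m - k) * ((- \<beta> - of_nat k) gchoose (m - k)) = pochhammer (\<beta> + of_nat k) (m - k) / fact (m - k)"
      by (simp add: gbinomial_pochhammer algebra_simps)
    have "of_nat ((3 * k) choose k) * (- 4 / 27) ^ k * (-1) ^ (m - k) * ((- \<beta> - of_nat k) gchoose (m - k))
      = (of_nat ((3 * k) choose k) * (- 4 / 27) ^ k) * ((-1) ^ (m - k) * ((- \<beta> - of_nat k) gchoose (m - k)))"
      by (simp only: mult.assoc)
    also have "\<dots> = (-1) ^ k * (of_nat ((3 * k) choose k) * (4 / 27) ^ k) * (pochhammer (\<beta> + of_nat k) (m - k) / fact (m - k))"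
      unfolding e1 e2 by (simp only: mult_ac)
    also have "\<dots> = pochhammer \<beta> m / pochhammer (1 / 2) m *
        ((-1) ^ k * pochhammer (1 - \<beta>) k * pochhammer (1 / 2 + of_nat k) (m - k) / (fact k * fact (m - k)))"
      using half[of m] half[of k]
      unfolding c pochhammer_product[OF that, of \<beta>] pochhammer_product[OF that, of "1 / 2"]
      by (simp add: field_simps)
    finally show ?thesis .
  qed
  have "(\<Sum>k\<le>m. of_nat ((3 * k) choose k) * (- 4 / 27) ^ k * (-1) ^ (m - k) * ((- \<beta> - of_nat k) gchoose (m - k)))
    = pochhammer \<beta> m / pochhammer (1 / 2) m *
      (\<Sum>k\<le>m. (-1) ^ k * pochhammer (1 - \<beta>) k * pochhammer (1 / 2 + of_nat k) (m - k) / (fact k * fact (m - k)))"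
    unfolding sum_distrib_left by (rule sum.cong) (simp_all only: 1 atMost_iff)
  also have "\<dots> = pochhammer \<beta> m * pochhammer (\<beta> - 1 / 2) m / (pochhammer (1 / 2) m * fact m)"
    unfolding sum_pochhammer_Vandermonde by simp
  \<comment> \<open>Duplication formula: the arguments \<open>\<beta> - 1 / 2\<close> and
    \<open>\<beta>\<close> differ by 1/2, so numerator and denominator both merge into products of
    length \<open>2 * m\<close>.\<close>
  also have "\<dots> = pochhammer (2 * \<beta> - 1) (2 * m) / fact (2 * m)"
  proof -
    have "pochhammer (2 * \<beta> - 1) (2 * m) = 2 ^ (2 * m) * pochhammer (\<beta> - 1 / 2) m * pochhammer \<beta> m"
      using pochhammer_double[of "\<beta> - 1 / 2" m] by (simp add: right_diff_distrib)
    then show ?thesis by (simp add: fact_double)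
  qed
  also have "\<dots> = (1 - 2 * \<beta>) gchoose (2 * m)"
    by (simp add: gbinomial_pochhammer)
  finally show ?thesis .
qed

lemma coeff_one_plus_monom_power:
  fixes c :: "'a :: comm_ring_1"
  assumes "d > 0"
  shows "coeff ((1 + monom c d) ^ n) i = (if d dvd i then of_nat (n choose (i div d)) * c ^ (i div d) else 0)"
proof -
  have "(1 + monom c d) ^ n = (\<Sum>k\<le>n. monom (of_nat (n choose k) * c ^ k) (d * k))"
    unfolding add.commute[of 1] binomial_ring
    by (rule sum.cong) (auto simp: monom_power of_nat_poly smult_monom)
  then have "coeff ((1 + monom c d) ^ n) i = (\<Sum>k\<le>n. if d * k = i then of_nat (n choose k) * c ^ k else 0)"
    by (simp add: coeff_sum)
  also have "\<dots> = (\<Sum>k\<le>n. if k = i div d then (if d dvd i then of_nat (n choose k) * c ^ k else 0) else 0)"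
    using assms by (intro sum.cong) auto
  also have "\<dots> = (if d dvd i then of_nat (n choose (i div d)) * c ^ (i div d) else 0)"
    by (auto simp: sum.delta binomial_eq_0)
  finally show ?thesis .
qed

section \<open>Congruences of rationals modulo p and generalized binomial coefficients\<close>

text \<open>For prime \<open>p\<close> this says that x - y lies in p Z_(p). The numbers
  \<open>x\<close> and \<open>y\<close> themselves may have denominators divisible by
  \<open>p\<close>, so products are compared only after checking that the common factor is
  p-integral.\<close>

definition cong_loc :: "nat \<Rightarrow> rat \<Rightarrow> rat \<Rightarrow> bool" where
  "cong_loc p x y \<longleftrightarrow> (x - y) / of_nat p \<in> int_localization p"

context
  fixes p :: nat
  assumes p: "prime p"
begin

lemma int_localization_of_int [simp, intro]: "of_int a \<in> int_localization p"
proof -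
  have "of_int a = (of_int a / of_int 1 :: rat)" "\<not> int p dvd 1"
    using p by (auto simp: prime_nat_iff)
  then show ?thesis unfolding int_localization_def by blast
qed

lemma int_localization_of_nat [simp, intro]: "of_nat a \<in> int_localization p"
  using int_localization_of_int[of "int a"] by simp

lemma int_localization_fraction [intro]:
  "\<not> int p dvd b \<Longrightarrow> of_int a / of_int b \<in> int_localization p"
  unfolding int_localization_def by blast

lemma int_localization_mult [intro]:
  assumes "x \<in> int_localization p" "y \<in> int_localization p"
  shows "x * y \<in> int_localization p"
proof -
  obtain a b c d where "x = of_int a / of_int b" "y = of_int c / of_int d"
    "\<not> int p dvd b" "\<not> int p dvd d"
    using assms unfolding int_localization_def by blast
  then have "x * y = of_int (a * c) / of_int (b * d)" "\<not> int p dvd b * d"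
    using p by (auto simp: prime_dvd_mult_iff)
  then show ?thesis using int_localization_fraction by metis
qed

lemma int_localization_add [intro]:
  assumes "x \<in> int_localization p" "y \<in> int_localization p"
  shows "x + y \<in> int_localization p"
proof -
  obtain a b c d where *: "x = of_int a / of_int b" "y = of_int c / of_int d"
    "\<not> int p dvd b" "\<not> int p dvd d"
    using assms unfolding int_localization_def by blast
  then have "b \<noteq> 0" "d \<noteq> 0" by auto
  with * have "x + y = of_int (a * d + c * b) / of_int (b * d)" "\<not> int p dvd b * d"
    using p by (auto simp: prime_dvd_mult_iff add_frac_eq)
  then show ?thesis using int_localization_fraction by metis
qed

lemma int_localization_minus [intro]: "x \<in> int_localization p \<Longrightarrow> - x \<in> int_localization p"
  using int_localization_mult[OF int_localization_of_int[of "-1"], of x] by simp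

lemma int_localization_diff [intro]:
  "x \<in> int_localization p \<Longrightarrow> y \<in> int_localization p \<Longrightarrow> x - y \<in> int_localization p"
  using int_localization_add[OF _ int_localization_minus] by simp

lemma int_localization_power: "x \<in> int_localization p \<Longrightarrow> x ^ n \<in> int_localization p"
  by (induction n) (use int_localization_of_int[of 1] in auto)

text \<open>Modulo a power of \<open>p\<close> the denominator of \<open>c\<close> is invertible, so
  \<open>c\<close> behaves like an integer there, and a product of \<open>j\<close> consecutive
  integers is divisible by \<open>fact j\<close>.\<close>

lemma gbinomial_in_int_localization:
  assumes "c \<in> int_localization p"
  shows "c gchoose j \<in> int_localization p"
proof -
  obtain a b where ab: "c = of_int a / of_int b" and b: "\<not> int p dvd b"
    using assms unfolding int_localization_def by blast
  then have "b \<noteq> 0" by auto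
  define P where "P = (\<Prod>i = 0..<j. a - int i * b)"
  have gP: "c gchoose j = of_int P / (of_int b ^ j * of_nat (fact j))"
  proof -
    have "c - of_nat i = of_int (a - int i * b) / of_int b" for i
      using \<open>b \<noteq> 0\<close> by (simp add: ab field_simps)
    then have "(\<Prod>i = 0..<j. c - of_nat i) = of_int P / of_int b ^ j"
      by (simp add: prod_dividef P_def)
    then show ?thesis by (simp add: gbinomial_prod_rev)
  qed
  \<comment> \<open>Only the p-part \<open>p ^ v\<close> of the factorial has to cancel against
    \<open>P\<close>; the cofactor \<open>u\<close> may stay in the denominator.\<close>
  obtain v u where vu: "fact j = p ^ v * u" "\<not> p dvd u"
    by (rule multiplicity_decompose'[of "fact j :: nat" p]) (use p not_prime_unit[of p] fact_nonzero in blast)+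
  have "coprime b (int p ^ v)"
    using prime_imp_coprime[of "int p" b] b p by (simp add: coprime_commute)
  then obtain b' where b': "[b * b' = 1] (mod int p ^ v)"
    using cong_solve_coprime_int by blast
  (* The factor b'^j, a unit modulo p^v, turns P into a product of j consecutive integers. *)
  have "[b' ^ j * P = (\<Prod>i = 0..<j. a * b' - int i)] (mod int p ^ v)"
  proof -
    have "b' ^ j * P = (\<Prod>i = 0..<j. b' * (a - int i * b))"
      by (simp add: P_def prod.distrib)
    moreover have "[b' * (a - int i * b) = a * b' - int i] (mod int p ^ v)" for i
    proof -
      have "b' * (a - int i * b) = a * b' - int i * (b * b')" by (simp add: algebra_simps)
      then show ?thesis using cong_diff[OF cong_refl cong_mult[OF cong_refl b'], of "a * b'" "int i"] by simp
    qed
    ultimately show ?thesis by (metis (no_types, lifting) cong_prod)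
  qed
  moreover have "int p ^ v dvd (\<Prod>i = 0..<j. a * b' - int i)"
  proof -
    have "fact j dvd (\<Prod>i = 0..<j. a * b' - int i)"
      by (rule dvdI[OF gbinomial_int_mult_fact[symmetric]])
    moreover have "(fact j :: int) = int p ^ v * int u" using vu(1) by (metis of_nat_fact of_nat_mult of_nat_power)
    ultimately show ?thesis using dvd_mult_left by auto
  qed
  ultimately have "int p ^ v dvd b' ^ j * P"
    using cong_dvd_iff cong_sym by blast
  moreover have "coprime (int p ^ v) (b' ^ j)"
    using cong_imp_coprime[OF cong_sym[OF b']] by (auto simp: coprime_commute)
  ultimately have "int p ^ v dvd P" by (simp add: coprime_dvd_mult_right_iff)
  then obtain m where m: "P = int p ^ v * m" by blast
  have "c gchoose j = of_int m / of_int (b ^ j * int u)"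
    using vu p unfolding gP m by (simp add: prime_gt_0_nat)
  moreover have "\<not> int p dvd b ^ j * int u"
    using b vu(2) p prime_dvd_power[of "int p" b j] by (auto simp: prime_dvd_mult_iff)
  ultimately show ?thesis using int_localization_fraction[of "b ^ j * int u" m] by simp
qed

lemma cong_loc_refl [simp, intro]: "cong_loc p x x"
  using int_localization_of_int[of 0] by (simp add: cong_loc_def)

lemma cong_loc_add:
  "cong_loc p x y \<Longrightarrow> cong_loc p u v \<Longrightarrow> cong_loc p (x + u) (y + v)"
  using int_localization_add[of "(x - y) / of_nat p" "(u - v) / of_nat p"]
  by (simp add: cong_loc_def add_divide_distrib diff_divide_distrib algebra_simps)

lemma cong_loc_sym: "cong_loc p x y \<Longrightarrow> cong_loc p y x"
  using int_localization_minus[of "(x - y) / of_nat p"]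
  by (simp add: cong_loc_def diff_divide_distrib)

lemma cong_loc_trans [trans]: "cong_loc p x y \<Longrightarrow> cong_loc p y z \<Longrightarrow> cong_loc p x z"
  using int_localization_add[of "(x - y) / of_nat p" "(y - z) / of_nat p"]
  by (simp add: cong_loc_def add_divide_distrib diff_divide_distrib algebra_simps)

lemma cong_loc_mult_left:
  "c \<in> int_localization p \<Longrightarrow> cong_loc p x y \<Longrightarrow> cong_loc p (c * x) (c * y)"
  using int_localization_mult[of c "(x - y) / of_nat p"]
  by (simp add: cong_loc_def diff_divide_distrib algebra_simps)

lemma cong_loc_sum:
  "(\<And>i. i \<in> A \<Longrightarrow> cong_loc p (g i) (h i)) \<Longrightarrow> cong_loc p (sum g A) (sum h A)"
  by (induction A rule: infinite_finite_induct) (auto intro!: cong_loc_add)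

text \<open>Absorption extracts the factor \<open>p ^ f * d / i\<close>, and \<open>i\<close>
  contains \<open>p\<close> to a power less than \<open>f\<close>.\<close>

lemma cong_loc_gbinomial_power_multiple:
  assumes "d \<in> int_localization p" "0 < i" "\<not> p ^ f dvd i"
  shows "cong_loc p ((of_nat (p ^ f) * d) gchoose i) 0"
proof -
  obtain v u where vu: "i = p ^ v * u" "\<not> p dvd u"
    by (rule multiplicity_decompose'[of i p]) (use assms(2) p not_prime_unit[of p] in blast)+
  have "v < f"
    using assms(3) vu(1) by (metis dvd_triv_left le_imp_power_dvd dvd_trans not_le)
  \<comment> \<open>Here p^f / i = p * p^e / u, so one factor \<open>p\<close> is left over for the
    congruence.\<close>
  then obtain e where e: "f = v + Suc e" by (metis less_iff_Suc_add add_Suc_right)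
  have "p > 0" using p by (rule prime_gt_0_nat)
  have "u > 0" using assms(2) vu by (cases u) auto
  have "((of_nat (p ^ f) * d) gchoose i) / of_nat p
     = of_nat (p ^ e) * (of_int 1 / of_int (int u)) * d * ((of_nat (p ^ f) * d - 1) gchoose (i - 1))"
    using \<open>p > 0\<close> \<open>u > 0\<close> unfolding gbinomial_absorption'[OF assms(2)]
    by (simp add: vu(1) e power_add field_simps)
  moreover have "\<dots> \<in> int_localization p"
    using vu(2) assms(1) 
    by (intro int_localization_mult gbinomial_in_int_localization int_localization_diff int_localization_fraction)
       (use int_localization_of_int[of 1] in \<open>auto simp flip: of_nat_power\<close>)
  ultimately show ?thesis by (simp add: cong_loc_def)
qed

text \<open>In the Vandermonde expansion every index 0 < i \<le> j is below \<open>p ^ f\<close>,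
  hence not divisible by it, and only the term i = 0 survives modulo \<open>p\<close>.\<close>

lemma cong_loc_gbinomial_add_power_multiple:
  assumes "c \<in> int_localization p" "d \<in> int_localization p" "j < p ^ f"
  shows "cong_loc p ((c + of_nat (p ^ f) * d) gchoose j) (c gchoose j)"
proof -
  have "(c + of_nat (p ^ f) * d) gchoose j = (\<Sum>i=0..j. (c gchoose (j - i)) * ((of_nat (p ^ f) * d) gchoose i))"
    by (subst add.commute, subst gbinomial_Vandermonde[symmetric]) (simp add: mult.commute)
  also have "cong_loc p \<dots> (\<Sum>i=0..j. (c gchoose (j - i)) * (if i = 0 then 1 else 0))"
  proof (intro cong_loc_sum cong_loc_mult_left gbinomial_in_int_localization assms(1))
    fix i assume "i \<in> {0..j}"
    then show "cong_loc p ((of_nat (p ^ f) * d) gchoose i) (if i = 0 then 1 else 0)"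
      using cong_loc_gbinomial_power_multiple[OF assms(2), of i f] assms(3) nat_dvd_not_less[of i "p ^ f"]
      by (cases "i = 0") (auto simp del: of_nat_power)
  qed
  also have "\<dots> = c gchoose j" by (simp add: if_distrib sum.delta cong: if_cong)
  finally show ?thesis .
qed

text \<open>Coefficient form of (1 + s)^(c + q d) \<equiv> (1 + s)^c (1 + d s^q) modulo
  \<open>p\<close> and s^(2q): now i = q survives as well as i = 0.\<close>

lemma cong_loc_gbinomial_add_power_multiple_double:
  assumes "odd p" "c \<in> int_localization p" "d \<in> int_localization p" "j < 2 * p ^ f"
  shows "cong_loc p ((c + of_nat (p ^ f) * d) gchoose j)
           ((c gchoose j) + (if j \<ge> p ^ f then d * (c gchoose (j - p ^ f)) else 0))"
proof -
  define q where "q = p ^ f"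
  have q: "q > 0" "odd q" using p assms(1) by (auto simp: q_def prime_gt_0_nat)
  \<comment> \<open>Absorption at index \<open>q\<close> leaves d times
    \<open>(q d - 1) gchoose (q - 1)\<close>. Its lower index is below \<open>q\<close>, so it
    reduces to \<open>(-1) gchoose (q - 1)\<close>, which is (-1)^(q-1) = 1 because \<open>q\<close>
    is odd.\<close>
  have top: "cong_loc p ((of_nat q * d) gchoose q) d"
  proof -
    have "cong_loc p ((-1 + of_nat q * d) gchoose (q - 1)) ((-1) gchoose (q - 1))"
      unfolding q_def
      by (rule cong_loc_gbinomial_add_power_multiple)
         (use assms q int_localization_of_int[of "-1"] in \<open>auto simp: q_def\<close>)
    also have "(-1 :: rat) gchoose (q - 1) = 1"
      using gbinomial_pochhammer[of "-1 :: rat" "q - 1"] q by (simp flip: pochhammer_fact)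
    finally have "cong_loc p (d * ((-1 + of_nat q * d) gchoose (q - 1))) (d * 1)"
      using assms(3) by (intro cong_loc_mult_left)
    then show ?thesis
      using gbinomial_absorption'[OF q(1), of "of_nat q * d"] q by simp
  qed
  have "(c + of_nat q * d) gchoose j = (\<Sum>i=0..j. (c gchoose (j - i)) * ((of_nat q * d) gchoose i))"
    by (subst add.commute, subst gbinomial_Vandermonde[symmetric]) (simp add: mult.commute)
  also have "cong_loc p \<dots> (\<Sum>i=0..j. (c gchoose (j - i)) * ((if i = 0 then 1 else 0) + (if i = q then d else 0)))"
  proof (intro cong_loc_sum cong_loc_mult_left gbinomial_in_int_localization assms(2))
    fix i assume i: "i \<in> {0..j}"
    \<comment> \<open>Since i \<le> j < 2q, the only multiples of \<open>q\<close> in range are 0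
      and \<open>q\<close>.\<close>
    have "\<not> q dvd i" if "i \<noteq> 0" "i \<noteq> q"
    proof
      assume "q dvd i"
      then obtain k where k: "i = q * k" by blast
      then have "k \<ge> 2" using that by (cases k) (auto simp: numeral_2_eq_2 Suc_le_eq)
      then have "2 * q \<le> i" unfolding k by (simp add: mult.commute)
      then show False using i assms(4) by (simp add: q_def)
    qed
    then show "cong_loc p ((of_nat q * d) gchoose i) ((if i = 0 then 1 else 0) + (if i = q then d else 0))"
      using cong_loc_gbinomial_power_multiple[OF assms(3), of i f] top q
      by (auto simp: q_def)
  qed
  also have "\<dots> = (c gchoose j) + (if j \<ge> q then d * (c gchoose (j - q)) else 0)"
    by (simp add: distrib_left sum.distrib if_distrib[of "(*) _"] cong: if_cong)
  finally show ?thesis unfolding q_def .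
qed

end

section \<open>Clearing the denominators of the sum\<close>

lemma to_fract_power: "to_fract (a ^ n) = to_fract a ^ n"
  by (induction n) simp_all

lemma to_fract_of_nat: "to_fract (of_nat n) = of_nat n"
  by (induction n) simp_all

lemma to_fract_numeral: "to_fract (numeral n) = numeral n"
  using to_fract_of_nat[of "numeral n"] by simp

text \<open>The polynomial \<open>(1 - s^2)^N \<Sum>k\<le>N. binomial(3k, k) x^k\<close>.\<close>

definition cleared_poly :: "nat \<Rightarrow> rat poly" where
  "cleared_poly N = (\<Sum>k\<le>N. smult (of_nat ((3 * k) choose k) * (- 4 / 27) ^ k)
     (monom 1 (2 * k) * (1 + monom (-1) 2) ^ (N - k)))"

text \<open>With y = 1 - s^2 one has x y = -(4/27) s^2, so y^N x^k = (-4/27)^k s^(2k) y^(N-k) for k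
  \<le> N.\<close>

lemma to_fract_cleared_poly:
  assumes s: "s = to_fract [:0, 1:]" and x: "x = 4 * s ^ 2 / (27 * (s ^ 2 - 1))"
  shows "2 * (1 - s ^ 2) ^ N * (\<Sum>k\<le>N. of_nat ((3 * k) choose k) * x ^ k)
       = to_fract (smult 2 (cleared_poly N))"
proof -
  \<comment> \<open>The constant -4/27 inside the fraction field, tied to numerals there by 27 a =
    -4.\<close>
  define a where "a = to_fract [:- 4 / 27 :: rat:]"
  have "27 * a = to_fract (27 * [:- 4 / 27:])"
    unfolding a_def to_fract_mult to_fract_numeral ..
  also have "27 * [:- 4 / 27 :: rat:] = - 4" by (simp add: numeral_poly)
  finally have a: "27 * a = - 4" by (simp add: to_fract_numeral)
  have S: "s ^ k = to_fract (monom 1 k)" for k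
    by (simp add: s monom_altdef flip: to_fract_power)
  define y where "y = 1 - s ^ 2"
  have y: "y = to_fract (1 + monom (-1) 2)"
    by (simp add: y_def S flip: minus_monom)
  \<comment> \<open>The constant coefficient 1 shows that y \<noteq> 0, which permits cancelling it
    in x y.\<close>
  have "coeff (1 + monom (-1) 2 :: rat poly) 0 \<noteq> 0" by simp
  then have "y \<noteq> 0" unfolding y to_fract_eq_0_iff by (metis coeff_0)
  have "(27 :: rat poly fract) \<noteq> 0"
    unfolding to_fract_numeral[symmetric] to_fract_eq_0_iff by simp
  have "x * y = a * s ^ 2"
  proof -
    have "27 * (x * y) = 27 * (a * s ^ 2)"
    proof -
      have "s ^ 2 - 1 = - y" by (simp add: y_def)
      then have "27 * (x * y) = - 4 * s ^ 2" unfolding x using \<open>y \<noteq> 0\<close> \<open>27 \<noteq> 0\<close>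
        by simp
      also have "\<dots> = 27 * (a * s ^ 2)" unfolding a[symmetric] by (simp only: mult.assoc)
      finally show ?thesis .
    qed
    then show ?thesis using \<open>27 \<noteq> 0\<close> by simp
  qed
  have "y ^ N * (of_nat ((3 * k) choose k) * x ^ k)
      = to_fract (smult (of_nat ((3 * k) choose k) * (- 4 / 27) ^ k) (monom 1 (2 * k) * (1 + monom (-1) 2) ^ (N - k)))"
    if "k \<le> N" for k
  proof -
    have "y ^ N = y ^ k * y ^ (N - k)" using that by (simp flip: power_add)
    then have "y ^ N * (of_nat ((3 * k) choose k) * x ^ k)
        = of_nat ((3 * k) choose k) * (x * y) ^ k * y ^ (N - k)"
      by (simp add: power_mult_distrib mult_ac)
    also have "\<dots> = of_nat ((3 * k) choose k) * a ^ k * (s ^ (2 * k) * y ^ (N - k))"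
      unfolding \<open>x * y = a * s ^ 2\<close> power_mult_distrib power_mult[of s 2] by (simp only: mult_ac)
    also have "\<dots> = to_fract (of_nat ((3 * k) choose k) * [:- 4 / 27:] ^ k * (monom 1 (2 * k) * (1 + monom (-1) 2) ^ (N - k)))"
      by (simp only: to_fract_mult to_fract_power to_fract_of_nat a_def S y)
    also have "of_nat ((3 * k) choose k) * [:- 4 / 27 :: rat:] ^ k = [:of_nat ((3 * k) choose k) * (- 4 / 27) ^ k:]"
      by (simp add: of_nat_poly poly_const_pow)
    finally show ?thesis by simp
  qed
  then have "y ^ N * (\<Sum>k\<le>N. of_nat ((3 * k) choose k) * x ^ k) = to_fract (cleared_poly N)"
    unfolding sum_distrib_left cleared_poly_def to_fract_sum by (intro sum.cong) auto
  moreover have "to_fract (smult 2 (cleared_poly N)) = 2 * to_fract (cleared_poly N)"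
    by (simp add: numeral_poly flip: to_fract_numeral to_fract_mult)
  ultimately show ?thesis by (simp add: y_def mult.assoc)
qed

lemma coeff_cleared_poly_odd: "odd i \<Longrightarrow> coeff (cleared_poly N) i = 0"
  by (auto simp: cleared_poly_def coeff_sum coeff_monom_mult coeff_one_plus_monom_power intro!: sum.neutral)

text \<open>Summands with k > m start in degree 2k > 2m and contribute nothing.\<close>

lemma coeff_cleared_poly_even:
  assumes "m \<le> N"
  shows "coeff (cleared_poly N) (2 * m) = (\<Sum>k\<le>m. of_nat ((3 * k) choose k) * (- 4 / 27) ^ k *
     (-1) ^ (m - k) * of_nat ((N - k) choose (m - k)))"
proof -
  have "coeff (cleared_poly N) (2 * m) = (\<Sum>k\<le>N. if k \<le> m then of_nat ((3 * k) choose k) * (- 4 / 27) ^ k *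
     (-1) ^ (m - k) * of_nat ((N - k) choose (m - k)) else 0)"
    unfolding cleared_poly_def coeff_sum
    by (rule sum.cong) (auto simp: coeff_monom_mult coeff_one_plus_monom_power simp flip: right_diff_distrib')
  also have "\<dots> = (\<Sum>k\<le>m. of_nat ((3 * k) choose k) * (- 4 / 27) ^ k *
     (-1) ^ (m - k) * of_nat ((N - k) choose (m - k)))"
    using assms by (intro sum.mono_neutral_cong_right) auto
  finally show ?thesis .
qed

text \<open>Every summand has degree at most 2k + 2(N - k) = 2N.\<close>

lemma coeff_cleared_poly_large:
  assumes "i > 2 * N"
  shows "coeff (cleared_poly N) i = 0"
proof (cases "odd i")
  case False
  then obtain m where m: "i = 2 * m" by blast
  have "(N - k) choose (m - k) = 0" if "k \<le> N" for k
    using that assms by (intro binomial_eq_0) (simp add: m)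
  then show ?thesis unfolding cleared_poly_def coeff_sum
    by (intro sum.neutral) (auto simp: m coeff_monom_mult coeff_one_plus_monom_power simp flip: right_diff_distrib')
qed (rule coeff_cleared_poly_odd)

section \<open>From coefficients to the two congruences\<close>

lemma rfun_cong_to_fract:
  assumes "p > 0" "\<And>i. cong_loc p (coeff P i) (coeff Q i)"
  shows "rfun_cong p (to_fract P) (to_fract Q)"
  unfolding rfun_cong_def
proof (intro exI conjI allI)
  show "coeff (smult (1 / of_nat p) (P - Q)) i \<in> int_localization p" for i
    using assms(2)[of i] by (simp add: cong_loc_def)
  show "to_fract P - to_fract Q = to_fract (smult (of_nat p) (smult (1 / of_nat p) (P - Q)))"
    using assms(1) by simp
qed

lemma fraction_power_3_in_int_localization:
  assumes "prime p" "p > 3"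
  shows "of_int a / 3 ^ k \<in> int_localization p"
proof -
  have "\<not> int p dvd 3" using assms(2) by (auto dest: zdvd_imp_le)
  then have "\<not> int p dvd 3 ^ k" using assms(1) prime_dvd_power[of "int p" 3 k] by auto
  then show ?thesis using int_localization_fraction[OF assms(1), of "3 ^ k" a] by simp
qed

text \<open>All lower indices \<open>m - k\<close> are below \<open>p ^ f\<close>, so each upper
  index \<open>N - k\<close> may be replaced by \<open>- \<beta> - of_nat k\<close>; the resulting
  sum is evaluated exactly by \<open>sum_binomial_gbinomial\<close>.\<close>

lemma cong_loc_coeff_cleared_poly:
  assumes p: "prime p" "p > 3" and \<beta>: "\<beta> = 1 / 3 \<or> \<beta> = 2 / 3"
    and d: "d \<in> int_localization p" and N: "of_nat N = of_nat (p ^ f) * d - \<beta>"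
    and m: "m \<le> N" "m < p ^ f"
  shows "cong_loc p (coeff (cleared_poly N) (2 * m)) ((1 - 2 * \<beta>) gchoose (2 * m))"
proof -
  note frac = fraction_power_3_in_int_localization[OF p]
  have \<beta>': "\<beta> \<in> int_localization p"
    using \<beta> frac[of 1 1] frac[of 2 1] by (elim disjE; hypsubst) simp_all
  have eq: "coeff (cleared_poly N) (2 * m) = (\<Sum>k\<le>m. of_nat ((3 * k) choose k) * (- 4 / 27) ^ k *
     (-1) ^ (m - k) * ((- \<beta> - of_nat k + of_nat (p ^ f) * d) gchoose (m - k)))"
    unfolding coeff_cleared_poly_even[OF m(1)]
  proof (rule sum.cong)
    fix k assume "k \<in> {..m}"
    then have "of_nat (N - k) = - \<beta> - of_nat k + of_nat (p ^ f) * d"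
      using m(1) N by (simp add: of_nat_diff)
    then show "of_nat ((3 * k) choose k) * (- 4 / 27) ^ k * (-1) ^ (m - k) * of_nat ((N - k) choose (m - k))
      = of_nat ((3 * k) choose k) * (- 4 / 27) ^ k * (-1) ^ (m - k) *
        ((- \<beta> - of_nat k + of_nat (p ^ f) * d) gchoose (m - k))"
      by (simp only: binomial_gbinomial[of "N - k"])
  qed simp
  have "cong_loc p (\<Sum>k\<le>m. of_nat ((3 * k) choose k) * (- 4 / 27) ^ k *
     (-1) ^ (m - k) * ((- \<beta> - of_nat k + of_nat (p ^ f) * d) gchoose (m - k))) (\<Sum>k\<le>m. of_nat ((3 * k) choose k) * (- 4 / 27) ^ k *
     (-1) ^ (m - k) * ((- \<beta> - of_nat k) gchoose (m - k)))"
  proof (intro cong_loc_sum cong_loc_mult_left cong_loc_gbinomial_add_power_multiple p d)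
    fix k
    have "- 4 / 27 \<in> int_localization p" using frac[of "-4" 3] by simp
    moreover have "- 1 \<in> int_localization p" using int_localization_of_int[OF p(1), of "-1"] by simp
    ultimately show "of_nat ((3 * k) choose k) * (- 4 / 27) ^ k * (-1) ^ (m - k) \<in> int_localization p"
      using p(1) by (intro int_localization_mult int_localization_power int_localization_of_nat)
    show "- \<beta> - of_nat k \<in> int_localization p"
      using p(1) \<beta>' by (intro int_localization_diff int_localization_minus int_localization_of_nat)
    show "m - k < p ^ f" using m by simp
  qed
  then show ?thesis
    unfolding eq sum_binomial_gbinomial[OF \<beta>] .
qed

text \<open>Here 2N + 1 = (1 - 2\<beta>) + (2/3) p^f, and the even coefficients up to degree 2N <
  p^f do not see the shift by (2/3) p^f.\<close>

lemma rfun_cong_cleared_sum_third: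
  fixes \<beta> :: rat
  assumes p: "prime p" "p > 3" and \<beta>: "\<beta> = 1 / 3 \<or> \<beta> = 2 / 3"
    and N: "of_nat N = of_nat (p ^ f) / 3 - \<beta>"
    and s: "s = to_fract [:0, 1:]" and x: "x = 4 * s ^ 2 / (27 * (s ^ 2 - 1))"
  shows "rfun_cong p (2 * (1 - s ^ 2) ^ N * (\<Sum>k\<le>N. of_nat ((3 * k) choose k) * x ^ k))
           ((1 + s) ^ (2 * N + 1) + (1 - s) ^ (2 * N + 1))"
proof -
  define Q :: "rat poly" where "Q = (1 + monom 1 1) ^ (2 * N + 1) + (1 + monom (-1) 1) ^ (2 * N + 1)"
  have rhs: "(1 + s) ^ (2 * N + 1) + (1 - s) ^ (2 * N + 1) = to_fract Q"
  proof -
    have "to_fract (1 + monom 1 1) = 1 + s" "to_fract (1 + monom (-1) 1) = 1 - s"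
      by (simp_all add: s monom_altdef flip: to_fract_1 to_fract_diff to_fract_add)
    then show ?thesis by (simp add: Q_def to_fract_power del: power_Suc)
  qed
  have coeffQ: "coeff Q i = (if even i then 2 * of_nat ((2 * N + 1) choose i) else 0)" for i
    by (simp add: Q_def coeff_one_plus_monom_power del: binomial_Suc_Suc power_Suc)
  have "of_nat (2 * N) < (of_nat (p ^ f) :: rat)"
    using \<beta> N prime_gt_0_nat[OF p(1)] by auto
  then have less: "2 * N < p ^ f" by (simp only: of_nat_less_iff)
  have third: "2 / 3 \<in> int_localization p" "1 - 2 * \<beta> \<in> int_localization p"
    using \<beta> fraction_power_3_in_int_localization[OF p, of "2" 1] fraction_power_3_in_int_localization[OF p, of "1" 1]
      fraction_power_3_in_int_localization[OF p, of "-1" 1] by (auto simp del: divide_eq_eq_numeral1 eq_divide_eq_numeral1)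
  have main: "cong_loc p (coeff (smult 2 (cleared_poly N)) i) (coeff Q i)" for i
  proof (cases "odd i \<or> i > 2 * N")
    case True
    \<comment> \<open>Both coefficients vanish: degree 2N + 1 is odd and cancels in
      \<open>Q\<close>, and beyond it the binomials are zero.\<close>
    then show ?thesis using p
      by (cases "i = 2 * N + 1") (auto simp: coeffQ coeff_cleared_poly_odd coeff_cleared_poly_large binomial_eq_0)
  next
    case False
    then obtain m where m: "i = 2 * m" "m \<le> N" by auto
    note [trans] = cong_loc_trans[OF p(1)]
    have "cong_loc p (coeff (cleared_poly N) (2 * m)) ((1 - 2 * \<beta>) gchoose (2 * m))"
      using p \<beta> N m less fraction_power_3_in_int_localization[OF p, of "1" 1]
      by (intro cong_loc_coeff_cleared_poly[where d = "1 / 3" and f = f]) auto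
    also have "cong_loc p ((1 - 2 * \<beta>) gchoose (2 * m)) ((1 - 2 * \<beta> + of_nat (p ^ f) * (2 / 3)) gchoose (2 * m))"
      by (rule cong_loc_sym[OF p(1)], rule cong_loc_gbinomial_add_power_multiple) (use p third m less in auto)
    also have "1 - 2 * \<beta> + of_nat (p ^ f) * (2 / 3) = of_nat (2 * N + 1)"
      using N by simp
    finally have "cong_loc p (coeff (cleared_poly N) (2 * m)) (of_nat ((2 * N + 1) choose (2 * m)))"
      using p by (simp add: binomial_gbinomial del: binomial_Suc_Suc)
    then have "cong_loc p (2 * coeff (cleared_poly N) (2 * m)) (2 * of_nat ((2 * N + 1) choose (2 * m)))"
      using int_localization_of_nat[OF p(1), of 2] by (intro cong_loc_mult_left[OF p(1)]) auto
    then show ?thesis by (simp add: coeffQ m del: binomial_Suc_Suc)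
  qed
  show ?thesis unfolding rhs to_fract_cleared_poly[OF s x]
    by (rule rfun_cong_to_fract[OF _ main]) (use p in auto)
qed

text \<open>Now \<open>2 * N\<close> may reach p^f, though it stays below 2 p^f. Since 1 - 2\<beta>
  = e - p^f / 3, the two-term reduction with d = -1/3 applies and yields the terms s^q / 3.\<close>

lemma rfun_cong_cleared_sum_two_thirds:
  fixes \<beta> :: rat
  assumes p: "prime p" "p > 3" and \<beta>: "\<beta> = 1 / 3 \<or> \<beta> = 2 / 3"
    and N: "of_nat N = of_nat (p ^ f) * (2 / 3) - \<beta>"
    and e: "e + p ^ f = 2 * N + 1"
    and s: "s = to_fract [:0, 1:]" and x: "x = 4 * s ^ 2 / (27 * (s ^ 2 - 1))"
  shows "rfun_cong p (2 * (1 - s ^ 2) ^ N * (\<Sum>k\<le>N. of_nat ((3 * k) choose k) * x ^ k))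
           ((1 + s) ^ e * (1 - s ^ (p ^ f) / 3) + (1 - s) ^ e * (1 + s ^ (p ^ f) / 3))"
proof -
  define q where "q = p ^ f"
  have "odd p" using p by (intro prime_odd_nat) auto
  then have q: "odd q" by (simp add: q_def)
  define Q :: "rat poly" where "Q = (1 + monom (- 1 / 3) q) * (1 + monom 1 1) ^ e + (1 + monom (1 / 3) q) * (1 + monom (-1) 1) ^ e"
  have rhs: "(1 + s) ^ e * (1 - s ^ (p ^ f) / 3) + (1 - s) ^ e * (1 + s ^ (p ^ f) / 3) = to_fract Q"
  proof -
    have 1: "to_fract (monom 1 (Suc 0)) = s" "to_fract (monom (-1) (Suc 0)) = - s"
      by (simp_all add: s monom_altdef flip: to_fract_uminus)
    have "to_fract (monom (1 / 3) q) * 3 = to_fract (monom (1 / 3) q * 3)"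
      by (simp only: to_fract_mult to_fract_numeral)
    also have "monom (1 / 3) q * 3 = (monom 1 q :: rat poly)"
      by (simp add: numeral_poly smult_monom)
    also have "to_fract \<dots> = s ^ q"
      by (simp add: s monom_altdef flip: to_fract_power)
    finally have 2: "to_fract (monom (1 / 3) q) = s ^ q / 3"
      using to_fract_eq_0_iff[of "3 :: rat poly"] by (simp add: eq_divide_eq to_fract_numeral)
    have 3: "monom (- 1 / 3) q = - (monom (1 / 3) q :: rat poly)" by (simp add: minus_monom)
    show ?thesis unfolding Q_def 3 q_def[symmetric] by (simp add: to_fract_power 1 2 mult.commute)
  qed
  \<comment> \<open>As \<open>q\<close> is odd, \<open>i - q\<close> and \<open>i\<close> have
    opposite parity; together with the opposite signs of s^q / 3 this doubles the shifted terms for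
    even \<open>i\<close> and cancels them for odd \<open>i\<close>.\<close>
  have coeffQ: "coeff Q i = (if even i then 2 * (of_nat (e choose i) + (if i \<ge> q then - 1 / 3 * of_nat (e choose (i - q)) else 0)) else 0)" for i
    using q by (auto simp: Q_def distrib_right coeff_monom_mult coeff_one_plus_monom_power)
  have "of_nat (2 * N) < (of_nat (2 * p ^ f) :: rat)"
    using \<beta> N prime_gt_0_nat[OF p(1)] by auto
  then have less: "2 * N < 2 * p ^ f" by (simp only: of_nat_less_iff)
  have third: "- 1 / 3 \<in> int_localization p"  "2 / 3 \<in> int_localization p"
    using fraction_power_3_in_int_localization[OF p, of "-1" 1] fraction_power_3_in_int_localization[OF p, of "2" 1] by auto
  have e': "of_nat e + of_nat (p ^ f) * (- 1 / 3) = 1 - 2 * \<beta>"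
  proof -
    have "of_nat e + of_nat (p ^ f) = (2 * of_nat N + 1 :: rat)"
      using arg_cong[OF e, of "of_nat :: nat \<Rightarrow> rat"] by simp
    then show ?thesis using N by (simp add: algebra_simps)
  qed
  have main: "cong_loc p (coeff (smult 2 (cleared_poly N)) i) (coeff Q i)" for i
  proof (cases "odd i \<or> i > 2 * N")
    case True
    \<comment> \<open>An even i > 2N is at least 2N + 2 > e + q, so both binomials in
      \<open>coeffQ\<close> vanish.\<close>
    then show ?thesis using p e
      by (cases "odd i") (auto simp: coeffQ coeff_cleared_poly_odd coeff_cleared_poly_large binomial_eq_0 q_def elim!: evenE)
  next
    case False
    then obtain m where m: "i = 2 * m" "m \<le> N" by auto
    note [trans] = cong_loc_trans[OF p(1)]
    have "cong_loc p (coeff (cleared_poly N) (2 * m)) ((1 - 2 * \<beta>) gchoose (2 * m))"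
      using p \<beta> N m less third
      by (intro cong_loc_coeff_cleared_poly[where d = "2 / 3" and f = f]) auto
    also have "cong_loc p ((1 - 2 * \<beta>) gchoose (2 * m))
        ((of_nat e gchoose (2 * m)) + (if 2 * m \<ge> p ^ f then (- 1 / 3) * (of_nat e gchoose (2 * m - p ^ f)) else 0))"
      unfolding e'[symmetric]
      by (rule cong_loc_gbinomial_add_power_multiple_double) (use p \<open>odd p\<close> third m less in auto)
    finally have "cong_loc p (2 * coeff (cleared_poly N) (2 * m))
       (2 * ((of_nat e gchoose (2 * m)) + (if 2 * m \<ge> p ^ f then (- 1 / 3) * (of_nat e gchoose (2 * m - p ^ f)) else 0)))"
      using int_localization_of_nat[OF p(1), of 2] p by (intro cong_loc_mult_left[OF p(1)]) auto
    then show ?thesis by (cases "p ^ f \<le> 2 * m") (simp_all add: coeffQ m q_def binomial_gbinomial)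
  qed
  show ?thesis unfolding rhs to_fract_cleared_poly[OF s x]
    by (rule rfun_cong_to_fract[OF _ main]) (use p in auto)
qed

section \<open>The symbol \<epsilon>, the exponents and the summation ranges\<close>

text \<open>The only nonzero square modulo 3 is 1.\<close>

lemma Legendre_3:
  assumes "\<not> 3 dvd q"
  shows "Legendre (int q) 3 = (if q mod 3 = 1 then 1 else -1)"
proof (cases "q mod 3 = 1")
  case True
  then have "[1\<^sup>2 = int q] (mod 3)" by (simp add: cong_def zmod_int[of q 3, simplified, symmetric])
  then have "QuadRes 3 (int q)" unfolding QuadRes_def by blast
  moreover have "\<not> 3 dvd int q" using assms by presburger
  ultimately show ?thesis using True by (simp add: Legendre_def cong_def dvd_eq_mod_eq_0)
next
  case False
  then have q: "int q mod 3 = 2" using assms by presburger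
  have "y\<^sup>2 mod 3 \<noteq> 2" for y :: int
  proof -
    have "y mod 3 = 0 \<or> y mod 3 = 1 \<or> y mod 3 = 2" by presburger
    then show ?thesis by (subst power_mod[symmetric]) auto
  qed
  with q False show ?thesis by (auto simp: Legendre_def QuadRes_def cong_def)
qed

theorem theorem7:
  fixes p f q :: nat and \<epsilon> :: int and s x :: "rat poly fract"
  assumes "prime p" and "p > 3" and "f \<ge> 1" and "q = p ^ f"
    and "\<epsilon> = Legendre (int q) 3"
    and "s = to_fract [:0, 1:]"
    and "x = 4 * s ^ 2 / (27 * (s ^ 2 - 1))"
  shows "rfun_cong p
           (2 * (1 - s ^ 2) ^ nat ((2 * int q - 3 + \<epsilon>) div 6) *
              (\<Sum>k | real k < real q / 3. of_nat ((3 * k) choose k) * x ^ k))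
           ((1 + s) ^ nat ((2 * int q + \<epsilon>) div 3) + (1 - s) ^ nat ((2 * int q + \<epsilon>) div 3)) \<and>
         rfun_cong p
           (2 * (1 - s ^ 2) ^ nat ((4 * int q - 3 - \<epsilon>) div 6) *
              (\<Sum>k | real k < 2 * real q / 3. of_nat ((3 * k) choose k) * x ^ k))
           ((1 + s) ^ nat ((int q - \<epsilon>) div 3) * (1 - s ^ q / 3) +
            (1 - s) ^ nat ((int q - \<epsilon>) div 3) * (1 + s ^ q / 3))"
proof -
  have "\<not> r dvd q" if "prime r" "r \<le> 3" for r
    using that assms(1,2,4) by (metis prime_dvd_power primes_dvd_imp_eq not_le)
  from this[of 2] this[of 3] have "\<not> 2 dvd q" "\<not> 3 dvd q" by auto
  define N where "N = nat ((2 * int q - 3 + \<epsilon>) div 6)"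
  define M where "M = nat ((4 * int q - 3 - \<epsilon>) div 6)"
  define e where "e = nat ((int q - \<epsilon>) div 3)"
  have "q mod 6 = 1 \<or> q mod 6 = 5" using \<open>\<not> 2 dvd q\<close> \<open>\<not> 3 dvd q\<close> by presburger
  then obtain j where "q = 6 * j + 1 \<and> \<epsilon> = 1 \<or> q = 6 * j + 5 \<and> \<epsilon> = -1"
  proof (elim disjE)
    assume "q mod 6 = 1"
    then have "q = 6 * (q div 6) + 1" "q mod 3 = 1" by presburger+
    with that show thesis using Legendre_3[OF \<open>\<not> 3 dvd q\<close>] assms(5) by auto
  next
    assume "q mod 6 = 5"
    then have "q = 6 * (q div 6) + 5" "q mod 3 \<noteq> 1" by presburger+
    with that show thesis using Legendre_3[OF \<open>\<not> 3 dvd q\<close>] assms(5) by auto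
  qed
  \<comment> \<open>If q \<equiv> 1 (mod 6), then N = (q - 1)/3 and M = (2q - 2)/3, so (\<beta>,
    \<beta>') = (1/3, 2/3); if q \<equiv> 5, then N = (q - 2)/3 and M = (2q - 1)/3, and the two
    values swap. The inequalities identify \<open>N\<close> and \<open>M\<close> as the largest
    summation indices.\<close>
  then obtain \<beta> \<beta>' :: rat where \<beta>: "\<beta> = 1 / 3 \<or> \<beta> = 2 / 3" "\<beta>' = 1 / 3 \<or> \<beta>' = 2 / 3"
    and N: "of_nat N = of_nat q / 3 - \<beta>" "nat ((2 * int q + \<epsilon>) div 3) = 2 * N + 1" "3 * N < q" "q < 3 * N + 3"
    and M: "of_nat M = of_nat q * (2 / 3) - \<beta>'" "e + q = 2 * M + 1" "3 * M < 2 * q" "2 * q < 3 * M + 3"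
  proof (elim disjE)
    assume q: "q = 6 * j + 1 \<and> \<epsilon> = 1"
    then have "N = 2 * j" "M = 4 * j" "e = 2 * j" "nat ((2 * int q + \<epsilon>) div 3) = 4 * j + 1"
      unfolding N_def M_def e_def by auto
    with q show thesis by (intro that[of "1 / 3" "2 / 3"]) (auto simp: field_simps)
  next
    assume q: "q = 6 * j + 5 \<and> \<epsilon> = -1"
    then have "N = 2 * j + 1" "M = 4 * j + 3" "e = 2 * j + 2" "nat ((2 * int q + \<epsilon>) div 3) = 4 * j + 3"
      unfolding N_def M_def e_def by auto
    with q show thesis by (intro that[of "2 / 3" "1 / 3"]) (auto simp: field_simps)
  qed
  have "{k. real k < real q / 3} = {..N}" "{k. real k < 2 * real q / 3} = {..M}"
    using N(3,4) M(3,4) by auto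
  moreover have "rfun_cong p (2 * (1 - s ^ 2) ^ N * (\<Sum>k\<le>N. of_nat ((3 * k) choose k) * x ^ k))
           ((1 + s) ^ (2 * N + 1) + (1 - s) ^ (2 * N + 1))"
    using assms N(1) \<beta>(1) by (intro rfun_cong_cleared_sum_third) auto
  moreover have "rfun_cong p (2 * (1 - s ^ 2) ^ M * (\<Sum>k\<le>M. of_nat ((3 * k) choose k) * x ^ k))
           ((1 + s) ^ e * (1 - s ^ q / 3) + (1 - s) ^ e * (1 + s ^ q / 3))"
    unfolding assms(4) using assms M(1,2) \<beta>(2) by (intro rfun_cong_cleared_sum_two_thirds) auto
  ultimately show ?thesis
    unfolding N(2) N_def[symmetric] M_def[symmetric] e_def[symmetric] by simp
qed

end
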